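(* Let $\theta$ be a primitive aperiodic bijective substitution in canonical form, of constant length $r$, over a finite alphabet $\mathcal{A}$, and suppose that the sets $P(i,j,k)$ partition $P_\theta$ into $n$ equivalence classes. Then there exist a substitution $\phi$ on the alphabet $\mathcal{B}=\{0,\dots,n-1\}$ and a sliding block code $\Psi:(X_\theta,\sigma)\to(X_\phi,\sigma)$. Moreover, $\Psi$ is a $|P(i,j,k)|$-to-$1$ extension, i.e. $\Psi$ is a surjective homomorphism each of whose fibers has exactly $|P(i,j,k)|$ points (the common cardinality of the sets $P(i,j,k)$).
   Context: Words are indexed from $0$: $\theta(a)=\theta(a)_0\ldots\theta(a)_{r-1}$. The alphabet $\mathcal{A}$ is $\{0,1,\dots,s\}$ for some $s$. A substitution $\theta:\mathcal{A}\to\mathcal{A}^{<\mathbb{N}}$ is extended to finite and bi-infinite words by concatenation (keeping the origin fixed). It has constant length $r$ if $|\theta(a)|=r$ for all $a$. It is aperiodic if its fixed point is not periodic under the shift and $\theta(a)\ne\theta(b)$ for $a\neq b$. It is bijective if $\theta(a)_m\ne\theta(b)_m$ for all letters $a\ne b$ and all $0\le m\le r-1$. It is in canonical form if $\theta(a)_0=\theta(a)_{r-1}=a$ for every letter $a$. $\sigma$ is the shift $\sigma(x)_m=x_{m+1}$, and $X_\theta\subset\mathcal{A}^{\mathbb{Z}}$ is the orbit closure of a bi-infinite fixed point of $\theta$ (for primitive $\theta$: the set of bi-infinite words all of whose finite subwords occur in some $\theta^k(a)$); similarly $X_\phi\subset\mathcal{B}^{\mathbb{Z}}$. A finite word is $\theta$-legal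 if it occurs in some element of $X_\theta$; $P_\theta$ is the set of $\theta$-legal two-letter words. Height: let $x$ be a bi-infinite fixed point of $\theta$ with $x_0=0$, $M=\{m\ge 1:x_m=0\}$, $d_\theta=\gcd M$; then $h(\theta)=\max\{m\ge1:\gcd(m,r)=1,\ m\mid d_\theta\}$. Letter classes: for $a\in\mathcal{A}$ let $z(a)$ be the residue mod $h(\theta)$ of the least $m\ge0$ such that $\theta^k(a)_m=0$ for some $k\ge 1$. For $p\in\{0,\dots,h(\theta)-1\}$, $S_p=\{a\in\mathcal{A}: z(a)\equiv -p \bmod h(\theta)\}$. For $0\le i\le h(\theta)-1$, $k\ge1$, $0\le j\le r^k-2$, $P(i,j,k)=\{\theta^k(a)_j\theta^k(a)_{j+1}: a\in S_i\}$. The collection partitions $P_\theta$ if any two of these sets are equal or disjoint and their union is $P_\theta$; the equivalence classes are the distinct sets $P(i,j,k)$. (For bijective $\theta$ the $S_i$ are equicardinal, so all $P(i,j,k)$ have the same cardinality.) A sliding block code $\Psi:X\to Y$ between shift spaces is a map for which there are integers $m,l$ with $-m\le l$ and a block map $F$ such that $\Psi(x)_i=F(x_{i-m}x_{i-m+1}\ldots x_{i+l})$ for all $i\in\mathbb{Z}$. *)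

theory Defs
  imports Main "HOL-Library.Sublist" "HOL-Library.Disjoint_Sets"
begin

text \<open>
  Letters are natural numbers, finite words are lists, and bi-infinite words are functions
  on the integers.  A substitution is given by a function on letters, of which only the values on
  the alphabet \<open>A\<close> matter.
\<close>

type_synonym biword = "int \<Rightarrow> nat"

definition substitution :: "nat set \<Rightarrow> (nat \<Rightarrow> nat list) \<Rightarrow> bool" where
  "substitution A \<theta> \<longleftrightarrow> (\<forall>a\<in>A. \<theta> a \<noteq> [] \<and> set (\<theta> a) \<subseteq> A)"

definition subst_word :: "(nat \<Rightarrow> nat list) \<Rightarrow> nat list \<Rightarrow> nat list" where
  "subst_word \<theta> w = concat (map \<theta> w)"

definition subst_pow :: "(nat \<Rightarrow> nat list) \<Rightarrow> nat \<Rightarrow> nat \<Rightarrow> nat list" where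
  "subst_pow \<theta> k a = (subst_word \<theta> ^^ k) [a]"

text \<open>
  The image of a bi-infinite word is \<open>\<dots> \<theta>(x\<^sub>-\<^sub>2) \<theta>(x\<^sub>-\<^sub>1) . \<theta>(x\<^sub>0) \<theta>(x\<^sub>1) \<dots>\<close>, with \<open>\<theta>(x\<^sub>0)\<close> starting at the
  origin.  As the words \<open>\<theta>(a)\<close> are nonempty, the letter at position \<open>i \<ge> 0\<close> lies in
  \<open>\<theta>(x\<^sub>0 \<dots> x\<^sub>i)\<close>, and the letter at position \<open>i < 0\<close> lies in \<open>\<theta>(x\<^sub>i \<dots> x\<^sub>-\<^sub>1)\<close>, where it is found
  by counting from the right end.
\<close>
definition subst_bi :: "(nat \<Rightarrow> nat list) \<Rightarrow> biword \<Rightarrow> biword" where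
  "subst_bi \<theta> x i =
     (if 0 \<le> i then subst_word \<theta> (map x [0..i]) ! nat i
      else let w = subst_word \<theta> (map x [i..-1]) in w ! nat (int (length w) + i))"

definition shift :: "biword \<Rightarrow> biword" where
  "shift x m = x (m + 1)"

definition shift_periodic :: "biword \<Rightarrow> bool" where
  "shift_periodic x \<longleftrightarrow> (\<exists>p\<ge>1. (shift ^^ p) x = x)"

definition subst_shift :: "nat set \<Rightarrow> (nat \<Rightarrow> nat list) \<Rightarrow> biword set" where
  "subst_shift A \<theta> = {x. \<forall>i j. \<exists>a\<in>A. \<exists>k. sublist (map x [i..j]) (subst_pow \<theta> k a)}"

text \<open>
  Membership in \<^term>\<open>subst_shift A \<theta>\<close> matters here: a substitution in canonical form fixes a
  bi-infinite word for every choice of \<open>x\<^sub>-\<^sub>1\<close> and \<open>x\<^sub>0\<close>, even if the word \<open>x\<^sub>-\<^sub>1 x\<^sub>0\<close> straddling the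
  origin is not legal.
\<close>
definition fixed_points :: "nat set \<Rightarrow> (nat \<Rightarrow> nat list) \<Rightarrow> biword set" where
  "fixed_points A \<theta> = {x \<in> subst_shift A \<theta>. subst_bi \<theta> x = x}"

definition primitive :: "nat set \<Rightarrow> (nat \<Rightarrow> nat list) \<Rightarrow> bool" where
  "primitive A \<theta> \<longleftrightarrow> (\<exists>k\<ge>1. \<forall>a\<in>A. \<forall>b\<in>A. b \<in> set (subst_pow \<theta> k a))"

definition constant_length :: "nat set \<Rightarrow> nat \<Rightarrow> (nat \<Rightarrow> nat list) \<Rightarrow> bool" where
  "constant_length A r \<theta> \<longleftrightarrow> (\<forall>a\<in>A. length (\<theta> a) = r)"

text \<open>For primitive \<open>\<theta>\<close> it is irrelevant which of the fixed points is tested for periodicity.\<close>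
definition aperiodic :: "nat set \<Rightarrow> (nat \<Rightarrow> nat list) \<Rightarrow> bool" where
  "aperiodic A \<theta> \<longleftrightarrow> (\<exists>x\<in>fixed_points A \<theta>. \<not> shift_periodic x) \<and> inj_on \<theta> A"

definition bijective :: "nat set \<Rightarrow> nat \<Rightarrow> (nat \<Rightarrow> nat list) \<Rightarrow> bool" where
  "bijective A r \<theta> \<longleftrightarrow> (\<forall>a\<in>A. \<forall>b\<in>A. a \<noteq> b \<longrightarrow> (\<forall>m<r. \<theta> a ! m \<noteq> \<theta> b ! m))"

definition canonical_form :: "nat set \<Rightarrow> nat \<Rightarrow> (nat \<Rightarrow> nat list) \<Rightarrow> bool" where
  "canonical_form A r \<theta> \<longleftrightarrow> (\<forall>a\<in>A. \<theta> a ! 0 = a \<and> \<theta> a ! (r - 1) = a)"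

definition legal :: "nat set \<Rightarrow> (nat \<Rightarrow> nat list) \<Rightarrow> nat list \<Rightarrow> bool" where
  "legal A \<theta> w \<longleftrightarrow> (\<exists>x\<in>subst_shift A \<theta>. \<exists>i. map x [i..i + int (length w) - 1] = w)"

definition legal_pairs :: "nat set \<Rightarrow> (nat \<Rightarrow> nat list) \<Rightarrow> nat list set" where
  "legal_pairs A \<theta> = {w. length w = 2 \<and> legal A \<theta> w}"

text \<open>
  The height does not depend on the fixed point chosen: only nonnegative coordinates enter, and
  these are determined by \<open>x\<^sub>0 = 0\<close>.
\<close>
definition return_gcd :: "nat set \<Rightarrow> (nat \<Rightarrow> nat list) \<Rightarrow> nat" where
  "return_gcd A \<theta> =
     (let x = (SOME x. x \<in> fixed_points A \<theta> \<and> x 0 = 0) in Gcd {m::nat. m \<ge> 1 \<and> x (int m) = 0})"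

definition height :: "nat set \<Rightarrow> nat \<Rightarrow> (nat \<Rightarrow> nat list) \<Rightarrow> nat" where
  "height A r \<theta> = Max {m. m \<ge> 1 \<and> coprime m r \<and> m dvd return_gcd A \<theta>}"

definition letter_residue :: "nat set \<Rightarrow> nat \<Rightarrow> (nat \<Rightarrow> nat list) \<Rightarrow> nat \<Rightarrow> nat" where
  "letter_residue A r \<theta> a =
     (LEAST m. \<exists>k\<ge>1. m < length (subst_pow \<theta> k a) \<and> subst_pow \<theta> k a ! m = 0) mod height A r \<theta>"

definition letter_class :: "nat set \<Rightarrow> nat \<Rightarrow> (nat \<Rightarrow> nat list) \<Rightarrow> nat \<Rightarrow> nat set" where
  "letter_class A r \<theta> p =
     {a\<in>A. int (letter_residue A r \<theta> a) mod int (height A r \<theta>) = (- int p) mod int (height A r \<theta>)}"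

definition pair_class ::
    "nat set \<Rightarrow> nat \<Rightarrow> (nat \<Rightarrow> nat list) \<Rightarrow> nat \<Rightarrow> nat \<Rightarrow> nat \<Rightarrow> nat list set" where
  "pair_class A r \<theta> i j k =
     (\<lambda>a. [subst_pow \<theta> k a ! j, subst_pow \<theta> k a ! (j + 1)]) ` letter_class A r \<theta> i"

text \<open>The bound \<open>j + 2 \<le> r ^ k\<close> is \<open>j \<le> r ^ k - 2\<close> without truncated subtraction.\<close>
definition pair_classes :: "nat set \<Rightarrow> nat \<Rightarrow> (nat \<Rightarrow> nat list) \<Rightarrow> nat list set set" where
  "pair_classes A r \<theta> =
     {pair_class A r \<theta> i j k | i j k. i < height A r \<theta> \<and> 1 \<le> k \<and> j + 2 \<le> r ^ k}"

definition sliding_block_code :: "biword set \<Rightarrow> biword set \<Rightarrow> (biword \<Rightarrow> biword) \<Rightarrow> bool" where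
  "sliding_block_code X Y \<Psi> \<longleftrightarrow> \<Psi> ` X \<subseteq> Y \<and>
     (\<exists>(m::int) (l::int) F. - m \<le> l \<and> (\<forall>x\<in>X. \<forall>i. \<Psi> x i = F (map x [i - m..i + l])))"

text \<open>Sliding block codes are exactly the continuous shift-commuting maps between shift spaces.\<close>
definition extension_to_one ::
    "biword set \<Rightarrow> biword set \<Rightarrow> (biword \<Rightarrow> biword) \<Rightarrow> nat \<Rightarrow> bool" where
  "extension_to_one X Y \<Psi> c \<longleftrightarrow> sliding_block_code X Y \<Psi> \<and> \<Psi> ` X = Y \<and>
     (\<forall>y\<in>Y. finite {x\<in>X. \<Psi> x = y} \<and> card {x\<in>X. \<Psi> x = y} = c)"

end

theory Submission
  imports Defs
begin

text \<open>
  The code sends \<open>x\<close> to the sequence of classes of the pairs \<open>x\<^sub>i x\<^sub>i\<^sub>+\<^sub>1\<close>, and \<open>\<phi>\<close> sends the class of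
  \<open>ab\<close> to the classes of the \<open>r\<close> consecutive pairs of \<open>\<theta>(a)\<theta>(b)\<^sub>0\<close>. This is well defined: the pairs at
  positions \<open>j\<close> of \<open>\<theta>\<^sup>k(a)\<close>, for \<open>a\<close> in one letter class, go to the pairs at positions \<open>jr + t\<close> of
  \<open>\<theta>\<^sup>k\<^sup>+\<^sup>1(a)\<close>, which again form one class.

  By bijectivity a pair is determined within its class by either of its letters, so a point of the
  fiber over \<open>y\<close> is determined by its pair at the origin, which lies in the class \<open>y\<^sub>0\<close>. Conversely,
  every window of \<open>y\<close> is the code of a piece of some \<open>\<theta>\<^sup>k(c)\<close>; replacing \<open>c\<close> by the other letters of its
  letter class leaves the code unchanged and lets the pair at the origin run through the whole
  class. Hence the fiber is in bijection with the class \<open>y\<^sub>0\<close>.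
\<close>

section \<open>Substitutions and their powers on finite words\<close>

lemma subst_word_Nil: "subst_word \<theta> [] = []"
  by (simp add: subst_word_def)

lemma subst_word_Cons: "subst_word \<theta> (a # w) = \<theta> a @ subst_word \<theta> w"
  by (simp add: subst_word_def)

lemma subst_word_append: "subst_word \<theta> (u @ v) = subst_word \<theta> u @ subst_word \<theta> v"
  by (simp add: subst_word_def)

text \<open>Iterates of a map that respects concatenation respect it too, so they are determined by
  their values on single letters. This allows \<open>subst_pow \<theta> k\<close> to be treated as a
  substitution in its own right.\<close>

lemma funpow_subst_word: "(subst_word \<theta> ^^ k) w = subst_word (subst_pow \<theta> k) w"
proof -
  have app: "(subst_word \<theta> ^^ k) (u @ v) = (subst_word \<theta> ^^ k) u @ (subst_word \<theta> ^^ k) v" for u v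
    by (induction k) (simp_all add: subst_word_append)
  have nil: "(subst_word \<theta> ^^ k) [] = []"
    by (induction k) (simp_all add: subst_word_Nil)
  show ?thesis
  proof (induction w)
    case Nil
    show ?case by (simp only: nil subst_word_Nil)
  next
    case (Cons a w)
    have "(subst_word \<theta> ^^ k) (a # w) = subst_pow \<theta> k a @ (subst_word \<theta> ^^ k) w"
      using app[of "[a]" w] by (simp add: subst_pow_def)
    then show ?case unfolding Cons by (simp only: subst_word_Cons)
  qed
qed

lemma subst_pow_0: "subst_pow \<theta> 0 a = [a]"
  by (simp add: subst_pow_def)

lemma subst_pow_1: "subst_pow \<theta> (Suc 0) a = \<theta> a"
  by (simp add: subst_pow_def subst_word_def)

lemma subst_pow_add: "subst_pow \<theta> (k + l) a = subst_word (subst_pow \<theta> k) (subst_pow \<theta> l a)"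
  unfolding subst_pow_def[of _ "k + l"] funpow_add
  by (simp add: funpow_subst_word) (simp add: subst_pow_def funpow_subst_word)

lemma subst_pow_Suc: "subst_pow \<theta> (Suc k) a = subst_word \<theta> (subst_pow \<theta> k a)"
  by (simp add: subst_pow_def)

lemma length_subst_word:
  assumes "constant_length A r \<theta>" "set w \<subseteq> A"
  shows "length (subst_word \<theta> w) = length w * r"
  using assms by (induction w) (auto simp: subst_word_def constant_length_def)

lemma set_subst_word:
  assumes "substitution A \<theta>" "set w \<subseteq> A"
  shows "set (subst_word \<theta> w) \<subseteq> A"
  using assms by (auto simp: subst_word_def substitution_def)

lemma nth_subst_word:
  assumes "constant_length A r \<theta>" "set w \<subseteq> A" "i < length w" "m < r"
  shows "subst_word \<theta> w ! (i * r + m) = \<theta> (w ! i) ! m"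
  using assms(2,3)
proof (induction w arbitrary: i)
  case (Cons a w)
  have len: "length (\<theta> a) = r" using Cons.prems assms(1) by (simp add: constant_length_def)
  show ?case
  proof (cases i)
    case 0
    then show ?thesis using len assms(4) by (simp add: subst_word_def nth_append)
  next
    case (Suc i')
    then have "subst_word \<theta> (a # w) ! (i * r + m) = subst_word \<theta> w ! (i' * r + m)"
      using len by (simp add: subst_word_def nth_append add.assoc)
    then show ?thesis using Cons Suc by simp
  qed
qed simp

lemma set_subst_pow:
  assumes "substitution A \<theta>" "a \<in> A"
  shows "set (subst_pow \<theta> k a) \<subseteq> A"
  by (induction k) (simp_all add: subst_pow_0 assms subst_pow_Suc set_subst_word)

lemma length_subst_pow:
  assumes "substitution A \<theta>" "constant_length A r \<theta>" "a \<in> A"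
  shows "length (subst_pow \<theta> k a) = r ^ k"
  by (induction k)
    (simp_all add: subst_pow_0 subst_pow_Suc length_subst_word[OF assms(2) set_subst_pow[OF assms(1,3)]])

text \<open>This is \<open>nth_subst_word\<close> for the substitution \<open>\<theta>^k\<close> of
  length \<open>r ^ k\<close>; all later base \<open>r\<close> addressing of positions rests on
  it.\<close>

lemma nth_subst_pow_add:
  assumes "substitution A \<theta>" "constant_length A r \<theta>" "a \<in> A" "i < r ^ l" "m < r ^ k"
  shows "subst_pow \<theta> (k + l) a ! (i * r ^ k + m) = subst_pow \<theta> k (subst_pow \<theta> l a ! i) ! m"
proof -
  have "constant_length A (r ^ k) (subst_pow \<theta> k)"
    using length_subst_pow[OF assms(1,2)] by (simp add: constant_length_def)
  then show ?thesis
    unfolding subst_pow_add using assms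
    by (intro nth_subst_word[where A = A]) (simp_all add: set_subst_pow length_subst_pow)
qed

section \<open>Windows of bi-infinite words and images under a substitution\<close>

lemma map_upto_two: "map x [i..i + 1] = [x i, x (i + 1)]"
  by (simp add: upto.simps)

text \<open>Every interval lies in a window symmetric about the origin, so symmetric windows
  suffice. The index \<open>t\<close> is where the origin falls, and \<open>N \<le> t\<close> keeps
  \<open>nat (int t + u)\<close> from truncating.\<close>

lemma subst_shift_iff:
  "x \<in> subst_shift A \<theta> \<longleftrightarrow>
     (\<forall>N. \<exists>a\<in>A. \<exists>k t. N \<le> t \<and> t + N < length (subst_pow \<theta> k a) \<and>
        (\<forall>u. \<bar>u\<bar> \<le> int N \<longrightarrow> x u = subst_pow \<theta> k a ! nat (int t + u)))"
  (is "_ \<longleftrightarrow> ?R")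
proof
  assume x: "x \<in> subst_shift A \<theta>"
  show ?R
  proof
    fix N
    obtain a k where a: "a \<in> A" and "sublist (map x [- int N..int N]) (subst_pow \<theta> k a)"
      using x unfolding subst_shift_def by blast
    then obtain p s where w: "subst_pow \<theta> k a = p @ map x [- int N..int N] @ s"
      unfolding sublist_def by blast
    have "x u = subst_pow \<theta> k a ! nat (int (length p + N) + u)" if "\<bar>u\<bar> \<le> int N" for u
    proof -
      have "nat (int (length p + N) + u) = length p + nat (u + int N)" using that by simp
      moreover have "nat (u + int N) < length [- int N..int N]" using that by simp
      ultimately have "subst_pow \<theta> k a ! nat (int (length p + N) + u) = x (- int N + int (nat (u + int N)))"
        unfolding w by (simp add: nth_append)
      moreover have "- int N + int (nat (u + int N)) = u" using that by simp
      ultimately show ?thesis by simp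
    qed
    then show "\<exists>a\<in>A. \<exists>k t. N \<le> t \<and> t + N < length (subst_pow \<theta> k a) \<and>
        (\<forall>u. \<bar>u\<bar> \<le> int N \<longrightarrow> x u = subst_pow \<theta> k a ! nat (int t + u))"
      using a by (intro bexI[of _ a] exI[of _ k] exI[of _ "length p + N"]) (auto simp: w)
  qed
next
  assume R: ?R
  have "\<exists>a\<in>A. \<exists>k. sublist (map x [i..j]) (subst_pow \<theta> k a)" for i j
  proof -
    define N where "N = nat (max \<bar>i\<bar> \<bar>j\<bar>)"
    obtain a k t where a: "a \<in> A" and t: "N \<le> t" "t + N < length (subst_pow \<theta> k a)"
      and x: "\<And>u. \<bar>u\<bar> \<le> int N \<Longrightarrow> x u = subst_pow \<theta> k a ! nat (int t + u)"
      using R by meson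
    let ?w = "subst_pow \<theta> k a"
    have N: "\<bar>i\<bar> \<le> int N" "\<bar>j\<bar> \<le> int N" by (auto simp: N_def)
    have "map x [i..j] = take (nat (j - i + 1)) (drop (nat (int t + i)) ?w)"
    proof (rule nth_equalityI)
      show "length (map x [i..j]) = length (take (nat (j - i + 1)) (drop (nat (int t + i)) ?w))"
        using N t by simp
      fix m assume "m < length (map x [i..j])"
      then have m: "i + int m \<le> j" "m < nat (j - i + 1)" by simp_all
      then have "x (i + int m) = ?w ! nat (int t + (i + int m))" using N by (intro x) simp
      moreover have "nat (int t + (i + int m)) = nat (int t + i) + m" using N t by simp
      ultimately show "map x [i..j] ! m = take (nat (j - i + 1)) (drop (nat (int t + i)) ?w) ! m"
        using m N t by simp
    qed
    then have "sublist (map x [i..j]) ?w"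
      by (metis sublist_take sublist_drop sublist_order.order_trans)
    then show ?thesis using a by blast
  qed
  then show "x \<in> subst_shift A \<theta>" by (simp add: subst_shift_def)
qed

lemma subst_shift_subset:
  assumes "substitution A \<theta>" "x \<in> subst_shift A \<theta>"
  shows "x i \<in> A"
proof -
  obtain a k t where "a \<in> A" "nat \<bar>i\<bar> \<le> t" "t + nat \<bar>i\<bar> < length (subst_pow \<theta> k a)"
    "x i = subst_pow \<theta> k a ! nat (int t + i)"
    using assms(2)[unfolded subst_shift_iff, rule_format, of "nat \<bar>i\<bar>"] by auto
  then show ?thesis
    using set_subst_pow[OF assms(1), of a k] nth_mem[of "nat (int t + i)" "subst_pow \<theta> k a"] by auto
qed

text \<open>Integer division rounds down, so one formula covers both halves of the definition:
  counting from the left end and counting from the right end.\<close>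

lemma subst_bi_nth:
  assumes "constant_length A r \<theta>" "0 < r" "\<And>i. x i \<in> A"
  shows "subst_bi \<theta> x i = \<theta> (x (i div int r)) ! nat (i mod int r)"
proof -
  let ?q = "i div int r" and ?m = "nat (i mod int r)"
  have m: "?m < r" using assms(2) by (simp add: nat_less_iff)
  have i: "i = ?q * int r + int ?m" using assms(2) by simp
  show ?thesis
  proof (cases "0 \<le> i")
    case True
    let ?w = "map x [0..i]"
    have q: "0 \<le> ?q" using True assms(2) by (simp add: pos_imp_zdiv_nonneg_iff)
    have "?q * 1 \<le> ?q * int r" using q assms(2) by (intro mult_left_mono) auto
    then have qi: "?q \<le> i" using i by linarith
    have "subst_word \<theta> ?w ! (nat ?q * r + ?m) = \<theta> (?w ! nat ?q) ! ?m"
      using nth_subst_word[OF assms(1), of ?w "nat ?q" ?m] assms(3) q qi m by auto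
    moreover have "nat i = nat ?q * r + ?m"
      using q i by (smt (verit) int_nat_eq nat_int of_nat_add of_nat_mult)
    moreover have "?w ! nat ?q = x ?q" using q qi by simp
    ultimately show ?thesis using True by (simp add: subst_bi_def)
  next
    case False
    let ?w = "map x [i..-1]" and ?n = "nat (?q - i)"
    have q: "?q < 0" using False assms(2) by (simp add: pos_imp_zdiv_neg_iff)
    have "(?q + 1) * int r \<le> (?q + 1) * 1" using q assms(2) by (intro mult_left_mono_neg) auto
    then have "?q * int r + int r \<le> ?q + 1" by (simp add: algebra_simps)
    then have qi: "i \<le> ?q" using i m by linarith
    have n: "?n < length ?w" using q qi by simp
    have set: "set ?w \<subseteq> A" using assms(3) by auto
    have "subst_word \<theta> ?w ! (?n * r + ?m) = \<theta> (?w ! ?n) ! ?m"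
      by (rule nth_subst_word[OF assms(1) set n m])
    \<comment> \<open>The image of \<open>x_i ... x_(-1)\<close> has length \<open>- i * r\<close>,
      which turns the count from the right end into block \<open>?n\<close>, offset
      \<open>?m\<close> from the left.\<close>
    moreover have "nat (int (length (subst_word \<theta> ?w)) + i) = ?n * r + ?m"
    proof -
      have "int (length (subst_word \<theta> ?w)) + i = (- i) * int r + (?q * int r + int ?m)"
        using length_subst_word[OF assms(1) set] False i by simp
      also have "\<dots> = int (?n * r + ?m)"
        using qi by (simp add: algebra_simps)
      finally show ?thesis by (metis nat_int)
    qed
    moreover have "?w ! ?n = x ?q" using n qi by simp
    ultimately show ?thesis using False by (simp add: subst_bi_def Let_def)
  qed
qed

section \<open>Letters of the powers of a canonical bijective substitution\<close>

locale canonical_substitution =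
  fixes A :: "nat set" and r :: nat and \<theta> :: "nat \<Rightarrow> nat list"
  assumes finite: "finite A"
    and zero: "0 \<in> A"
    and two_le: "2 \<le> r"
    and subst: "substitution A \<theta>"
    and const: "constant_length A r \<theta>"
    and prim: "primitive A \<theta>"
    and bij: "bijective A r \<theta>"
    and canon: "canonical_form A r \<theta>"
begin

abbreviation letter :: "nat \<Rightarrow> nat \<Rightarrow> nat \<Rightarrow> nat" where
  "letter k a j \<equiv> subst_pow \<theta> k a ! j"

abbreviation pair :: "nat \<Rightarrow> nat \<Rightarrow> nat \<Rightarrow> nat list" where
  "pair k a j \<equiv> [letter k a j, letter k a (j + 1)]"

lemma letter_in: "a \<in> A \<Longrightarrow> j < r ^ k \<Longrightarrow> letter k a j \<in> A"
  using set_subst_pow[OF subst, of a k] nth_mem[of j "subst_pow \<theta> k a"]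
  by (auto simp: length_subst_pow[OF subst const])

lemma letter_add:
  "a \<in> A \<Longrightarrow> i < r ^ l \<Longrightarrow> m < r ^ k \<Longrightarrow> letter (k + l) a (i * r ^ k + m) = letter k (letter l a i) m"
  by (rule nth_subst_pow_add[OF subst const])

lemma letter_Suc: "a \<in> A \<Longrightarrow> i < r ^ l \<Longrightarrow> m < r \<Longrightarrow> letter (Suc l) a (i * r + m) = \<theta> (letter l a i) ! m"
  using letter_add[of a i l m "Suc 0"] by (simp add: subst_pow_1)

lemma index_less: "i < r ^ l \<Longrightarrow> m < r ^ k \<Longrightarrow> i * r ^ k + m < r ^ (k + l)"
proof -
  assume "i < r ^ l" "m < r ^ k"
  then have "i * r ^ k + m < (i + 1) * r ^ k" by simp
  also have "(i + 1) * r ^ k \<le> r ^ l * r ^ k" using \<open>i < r ^ l\<close> by (intro mult_le_mono1) simp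
  finally show ?thesis by (simp add: power_add mult.commute)
qed

text \<open>Supplies an explicit exponent: position \<open>n\<close> always exists in
  \<open>\<theta>^n(a)\<close>.\<close>

lemma less_power: "n < r ^ n"
  using less_le_trans[OF less_exp power_mono[OF two_le]] by simp

text \<open>Bijectivity passes to powers: a column of \<open>\<theta>^k\<close> is a composition of
  columns of \<open>\<theta>\<close>, one for each base \<open>r\<close> digit of \<open>j\<close>,
  and each of these is injective.\<close>

lemma letter_inj:
  assumes "a \<in> A" "b \<in> A" "j < r ^ k" "letter k a j = letter k b j"
  shows "a = b"
  using assms(3,4)
proof (induction k arbitrary: j)
  case 0
  then show ?case by (simp add: subst_pow_0)
next
  case (Suc k)
  have j: "j div r < r ^ k" "j mod r < r"
    using Suc.prems two_le by (simp_all add: less_mult_imp_div_less mult.commute)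
  have "\<theta> (letter k a (j div r)) ! (j mod r) = \<theta> (letter k b (j div r)) ! (j mod r)"
    using letter_Suc[of a, OF _ j] letter_Suc[of b, OF _ j] Suc.prems assms by simp
  then have "letter k a (j div r) = letter k b (j div r)"
    using bij j letter_in assms unfolding bijective_def by blast
  then show ?case using Suc j by blast
qed

lemma letter_first: "a \<in> A \<Longrightarrow> letter k a 0 = a"
proof (induction k)
  case (Suc k)
  then show ?case
    using letter_Suc[of a 0 k 0] two_le canon by (simp add: canonical_form_def)
qed (simp add: subst_pow_0)

lemma letter_last: "a \<in> A \<Longrightarrow> letter k a (r ^ k - 1) = a"
proof (induction k)
  case (Suc k)
  have "r ^ k * r \<ge> r" using two_le by simp
  then have "r ^ Suc k - 1 = (r ^ k - 1) * r + (r - 1)"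
    using two_le by (simp add: diff_mult_distrib2 mult.commute)
  then show ?case
    using letter_Suc[of a "r ^ k - 1" k "r - 1"] Suc two_le canon by (simp add: canonical_form_def)
qed (simp add: subst_pow_0)

text \<open>As \<open>\<theta>^l(a)\<close> begins and ends with \<open>a\<close>, the word
  \<open>\<theta>^k(a)\<close> is both a prefix and a suffix of \<open>\<theta>^(k+l)(a)\<close>;
  the suffix half is \<open>letter_suffix\<close>.\<close>

lemma letter_prefix: "a \<in> A \<Longrightarrow> j < r ^ k \<Longrightarrow> letter (k + l) a j = letter k a j"
  using letter_add[of a 0 l j k] two_le by (simp add: letter_first)

lemma letter_suffix:
  assumes "a \<in> A" "j < r ^ k"
  shows "letter (k + l) a (r ^ (k + l) - r ^ k + j) = letter k a j"
proof -
  have "(r ^ l - 1) * r ^ k + j = r ^ (k + l) - r ^ k + j"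
    by (simp add: diff_mult_distrib2 power_add mult.commute)
  then show ?thesis
    using letter_add[of a "r ^ l - 1" l j k] letter_last[of a l] two_le assms by simp
qed

lemma primitive_exponent:
  obtains K where "1 \<le> K" "\<And>a b. a \<in> A \<Longrightarrow> b \<in> A \<Longrightarrow> \<exists>j<r ^ K. letter K a j = b"
  using prim length_subst_pow[OF subst const] unfolding primitive_def by (metis in_set_conv_nth)

text \<open>One more application of \<open>\<theta>\<close> puts \<open>a\<close> at the start of a
  block of length at least 2, so that it has a successor. In \<open>ex_pair_second\<close> the end
  of the block gives it a predecessor.\<close>

lemma ex_pair_first:
  assumes "a \<in> A"
  obtains l j where "1 \<le> l" "j + 1 < r ^ l" "letter l 0 j = a"
proof -
  obtain K j where K: "j < r ^ K" "letter K 0 j = a"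
    using primitive_exponent zero assms by metis
  have "letter (Suc K) 0 (j * r + 0) = \<theta> a ! 0"
    using letter_Suc[of 0 j K 0] K zero two_le by simp
  moreover have "j * r + 1 < r ^ Suc K"
    using index_less[of j K 1 1] K two_le by simp
  ultimately show ?thesis using that[of "Suc K" "j * r"] canon assms by (simp add: canonical_form_def)
qed

lemma ex_pair_second:
  assumes "a \<in> A"
  obtains l j where "1 \<le> j" "j < r ^ l" "letter l 0 j = a"
proof -
  obtain K j where K: "j < r ^ K" "letter K 0 j = a"
    using primitive_exponent zero assms by metis
  have "letter (Suc K) 0 (j * r + (r - 1)) = \<theta> a ! (r - 1)"
    using letter_Suc[of 0 j K "r - 1"] K zero two_le by simp
  moreover have "j * r + (r - 1) < r ^ Suc K"
    using index_less[of j K "r - 1" 1] K two_le by simp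
  ultimately show ?thesis using that[of "j * r + (r - 1)" "Suc K"] canon assms two_le
    by (simp add: canonical_form_def)
qed

section \<open>Fixed points\<close>

lemma subst_bi_letter:
  "(\<And>i. x i \<in> A) \<Longrightarrow> subst_bi \<theta> x i = \<theta> (x (i div int r)) ! nat (i mod int r)"
  using subst_bi_nth[OF const] two_le by simp

text \<open>Reading the fixed point equation digit by digit in base \<open>r\<close> leads back to
  the letter at the origin. Hence the choice made in \<open>return_gcd\<close> does not affect the
  nonnegative coordinates.\<close>

lemma fixed_point_letter:
  assumes "x \<in> fixed_points A \<theta>" "x 0 = 0" "n < r ^ k"
  shows "x (int n) = letter k 0 n"
  using assms(3)
proof (induction k arbitrary: n)
  case 0
  then show ?case using assms by (simp add: subst_pow_0)
next
  case (Suc k)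
  have n: "n div r < r ^ k" "n mod r < r"
    using Suc.prems two_le by (simp_all add: less_mult_imp_div_less mult.commute)
  have fp: "subst_bi \<theta> x = x" and "x \<in> subst_shift A \<theta>"
    using assms(1) by (simp_all add: fixed_points_def)
  then have "subst_bi \<theta> x (int n) = \<theta> (x (int n div int r)) ! nat (int n mod int r)"
    using subst_shift_subset[OF subst] by (intro subst_bi_letter)
  then have "x (int n) = \<theta> (x (int n div int r)) ! nat (int n mod int r)"
    unfolding fp .
  also have "\<dots> = \<theta> (letter k 0 (n div r)) ! (n mod r)"
    using Suc.IH[OF n(1)] by (simp only: zdiv_int[symmetric] zmod_int[symmetric] nat_int)
  also have "\<dots> = letter (Suc k) 0 n"
    using letter_Suc[OF zero n] by (simp only: div_mult_mod_eq)
  finally show ?case .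
qed

text \<open>Guarantees that the choice in \<open>return_gcd\<close> picks a fixed point. If
  \<open>c\<close> precedes an occurrence of 0 in some \<open>\<theta>^l(0)\<close>, the words
  \<open>\<theta>^k(c).\<theta>^k(0)\<close> extend one another around the origin by canonical form,
  and their limit is fixed.\<close>

lemma ex_fixed_point: "\<exists>x. x \<in> fixed_points A \<theta> \<and> x 0 = 0"
proof -
  obtain l p where p: "1 \<le> p" "p < r ^ l" and p0: "letter l 0 p = 0"
    using ex_pair_second[OF zero] by metis
  define c where "c = letter l 0 (p - 1)"
  have c: "c \<in> A" using letter_in[OF zero, of "p - 1" l] p by (simp add: c_def)
  \<comment> \<open>The origin is put at position \<open>p * r ^ k\<close> of
    \<open>\<theta>^(k+l)(0)\<close>, where the block \<open>\<theta>^k(c)\<close> ends and the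
    block \<open>\<theta>^k(0)\<close> starts.\<close>
  define w where "w k u = letter (k + l) 0 (nat (int (p * r ^ k) + u))" for k and u :: int
  have w_nonneg: "w k u = letter k 0 (nat u)" if "0 \<le> u" "u < int (r ^ k)" for k u
  proof -
    have "nat u < r ^ k" using that by (simp add: nat_less_iff)
    moreover have "nat (int (p * r ^ k) + u) = p * r ^ k + nat u" using that by linarith
    ultimately show ?thesis using letter_add[OF zero p(2), of "nat u" k] p0 by (simp add: w_def)
  qed
  have w_neg: "w k u = letter k c (nat (int (r ^ k) + u))" if "- int (r ^ k) \<le> u" "u < 0" for k u
  proof -
    have "p * r ^ k = (p - 1) * r ^ k + r ^ k" using p by (cases p) auto
    then have "nat (int (p * r ^ k) + u) = (p - 1) * r ^ k + nat (int (r ^ k) + u)"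
      using that by linarith
    moreover have "p - 1 < r ^ l" "nat (int (r ^ k) + u) < r ^ k" using p that by linarith+
    ultimately show ?thesis using letter_add[OF zero] by (simp only: w_def c_def)
  qed
  \<comment> \<open>Right of the origin this is the prefix property of \<open>\<theta>^k(0)\<close>,
    left of it the suffix property of \<open>\<theta>^k(c)\<close>.\<close>
  have stable: "w (k + d) u = w k u" if u: "- int (r ^ k) \<le> u" "u < int (r ^ k)" for k d u
  proof -
    have le: "r ^ k \<le> r ^ (k + d)" using two_le by (intro power_increasing) auto
    then have u': "- int (r ^ (k + d)) \<le> u" "u < int (r ^ (k + d))" using u by linarith+
    show ?thesis
    proof (cases "0 \<le> u")
      case True
      then show ?thesis
        using u u' w_nonneg letter_prefix[OF zero, of "nat u" k d] by (simp add: nat_less_iff)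
    next
      case False
      have "r ^ (k + d) - r ^ k + nat (int (r ^ k) + u) = nat (int (r ^ (k + d)) + u)"
        using le u by linarith
      moreover have "nat (int (r ^ k) + u) < r ^ k" using u False by linarith
      ultimately show ?thesis
        using u u' False w_neg letter_suffix[OF c, of "nat (int (r ^ k) + u)" k d] by simp
    qed
  qed
  \<comment> \<open>Level \<open>\<bar>u\<bar>\<close> already determines coordinate
    \<open>u\<close>, because \<open>\<bar>u\<bar> < r ^ nat \<bar>u\<bar>\<close>.\<close>
  define x where "x u = w (nat \<bar>u\<bar>) u" for u
  have x_eq: "x u = w k u" if "nat \<bar>u\<bar> \<le> k" for k u
  proof -
    have "- int (r ^ nat \<bar>u\<bar>) \<le> u" "u < int (r ^ nat \<bar>u\<bar>)"
      using less_power[of "nat \<bar>u\<bar>"] by linarith+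
    then show ?thesis using stable[of "nat \<bar>u\<bar>" u "k - nat \<bar>u\<bar>"] that by (simp add: x_def)
  qed
  have index: "0 \<le> int (p * r ^ k) + u" "nat (int (p * r ^ k) + u) < r ^ (k + l)" if "nat \<bar>u\<bar> \<le> k" for k u
  proof -
    have u: "\<bar>u\<bar> < int (r ^ k)" using that less_power[of k] by linarith
    have "1 * r ^ k \<le> p * r ^ k" using p by (intro mult_le_mono1)
    then show "0 \<le> int (p * r ^ k) + u" using u by linarith
    have "(p + 1) * r ^ k \<le> r ^ l * r ^ k" using p by (intro mult_le_mono1) simp
    then have "p * r ^ k + r ^ k \<le> r ^ (k + l)" by (simp add: power_add mult.commute)
    then show "nat (int (p * r ^ k) + u) < r ^ (k + l)" using u by linarith
  qed
  have xA: "x u \<in> A" for u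
    using letter_in[OF zero index(2)[of u "nat \<bar>u\<bar>"]] by (simp add: x_def w_def)
  have "x \<in> subst_shift A \<theta>"
    unfolding subst_shift_iff
  proof
    fix N
    have *: "nat \<bar>u\<bar> \<le> N" if "\<bar>u\<bar> \<le> int N" for u using that by simp
    have "N \<le> p * r ^ N"
      using index(1)[of "- int N" N] by linarith
    moreover have "p * r ^ N + N < length (subst_pow \<theta> (N + l) 0)"
      using index(2)[of "int N" N]
      by (simp add: length_subst_pow[OF subst const zero] flip: of_nat_add of_nat_mult of_nat_power)
    moreover have "\<forall>u. \<bar>u\<bar> \<le> int N \<longrightarrow> x u = letter (N + l) 0 (nat (int (p * r ^ N) + u))"
      using x_eq[OF *] by (simp add: w_def)
    ultimately show "\<exists>a\<in>A. \<exists>k t. N \<le> t \<and> t + N < length (subst_pow \<theta> k a) \<and>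
        (\<forall>u. \<bar>u\<bar> \<le> int N \<longrightarrow> x u = letter k a (nat (int t + u)))"
      using zero by blast
  qed
  moreover have "subst_bi \<theta> x i = x i" for i
  proof -
    \<comment> \<open>The level is chosen so that both \<open>i\<close> and \<open>q\<close> are
      settled. Coordinate \<open>q\<close> is read at level \<open>k\<close> and \<open>i\<close> at
      level \<open>Suc k\<close>, since \<open>\<theta>\<close> moves the origin from
      \<open>p * r ^ k\<close> to \<open>p * r ^ Suc k\<close>.\<close>
    define q m k where "q = i div int r" and "m = nat (i mod int r)" and "k = nat \<bar>i\<bar> + nat \<bar>q\<bar>"
    have m: "m < r" using two_le by (simp add: m_def nat_less_iff)
    have i: "i = q * int r + int m" using two_le by (simp add: m_def q_def)
    define J where "J = nat (int (p * r ^ k) + q)"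
    have q: "nat \<bar>q\<bar> \<le> k" by (simp add: k_def)
    have J: "J < r ^ (k + l)" "int J = int (p * r ^ k) + q" using index[OF q] by (simp_all add: J_def)
    have "int (p * r ^ Suc k) + i = int (J * r + m)"
      unfolding i of_nat_add of_nat_mult[of J] J(2) by (simp add: algebra_simps)
    then have "nat (int (p * r ^ Suc k) + i) = J * r + m" by (metis nat_int)
    then have "x i = letter (Suc (k + l)) 0 (J * r + m)"
      using x_eq[of i "Suc k"] by (simp add: w_def k_def)
    also have "\<dots> = \<theta> (letter (k + l) 0 J) ! m" by (rule letter_Suc[OF zero J(1) m])
    also have "letter (k + l) 0 J = x q" using x_eq[OF q] by (simp add: w_def J_def)
    finally show ?thesis using subst_bi_letter[OF xA] by (simp add: q_def m_def)
  qed
  moreover have "x 0 = 0" using p0 by (simp add: x_def w_def)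
  ultimately show ?thesis by (auto simp: fixed_points_def)
qed

section \<open>The height\<close>

lemma return_gcd_dvd:
  assumes "n < r ^ k" "letter k 0 n = 0"
  shows "return_gcd A \<theta> dvd n"
proof (cases "n = 0")
  case False
  define x where "x = (SOME x. x \<in> fixed_points A \<theta> \<and> x 0 = 0)"
  have "x \<in> fixed_points A \<theta> \<and> x 0 = 0" unfolding x_def by (rule someI_ex[OF ex_fixed_point])
  then have "x (int n) = 0" using fixed_point_letter[of x n k] assms by simp
  moreover have "return_gcd A \<theta> = Gcd {m. 1 \<le> m \<and> x (int m) = 0}"
    by (simp add: return_gcd_def x_def Let_def)
  ultimately show ?thesis using False by simp
qed simp

abbreviation h :: nat where "h \<equiv> height A r \<theta>"

text \<open>As \<open>\<theta>(0)\<close> ends in \<open>0\<close>, the return gcd divides \<open>r - 1\<close>; so it is coprime to \<open>r\<close> and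
  equals the height.\<close>

lemma return_gcd_dvd_pred: "return_gcd A \<theta> dvd r - 1"
  using return_gcd_dvd[of "r - 1" 1] letter_last[OF zero, of 1] two_le by simp

lemma height_eq: "h = return_gcd A \<theta>"
proof -
  let ?g = "return_gcd A \<theta>"
  have pos: "?g \<ge> 1" using return_gcd_dvd_pred two_le by (cases "?g = 0") auto
  have "coprime (r - 1) r" using coprime_Suc_right_nat[of "r - 1"] two_le by simp
  then have "coprime ?g r" using return_gcd_dvd_pred by (meson coprime_divisors dvd_refl)
  then show ?thesis
    unfolding height_def using pos
    by (intro Max_eqI) (auto intro: finite_subset[of _ "{..?g}"] dvd_imp_le)
qed

lemma height_pos: "0 < h"
  using return_gcd_dvd_pred two_le by (cases "h = 0") (auto simp: height_eq)

lemma height_dvd: "n < r ^ k \<Longrightarrow> letter k 0 n = 0 \<Longrightarrow> h dvd n"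
  by (simp add: height_eq return_gcd_dvd)

text \<open>From \<open>r = 1\<close> modulo \<open>h\<close>: scaling a position by
  \<open>r ^ k\<close> preserves its residue modulo \<open>h\<close>.\<close>

lemma height_dvd_power: "int h dvd int r ^ k - 1"
proof (induction k)
  case (Suc k)
  have "int h dvd int (r - 1)" using return_gcd_dvd_pred by (simp only: height_eq int_dvd_int_iff)
  then have "int h dvd int r - 1" using two_le by (simp add: of_nat_diff)
  then have "int h dvd int r * (int r ^ k - 1) + (int r - 1)" using Suc by (intro dvd_add dvd_mult)
  then show ?case by (simp add: algebra_simps)
qed simp

section \<open>Letter classes\<close>

text \<open>If \<open>a\<close> stands at position \<open>n\<close> of a power of
  \<open>\<theta>\<close> at 0, and \<open>z\<close> is the first position of 0 in the powers at
  \<open>a\<close>, then 0 stands at \<open>n * r ^ k' + z\<close> in a larger power. So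
  \<open>h\<close> divides this number, which is \<open>n + z\<close> modulo \<open>h\<close>. The
  sign in the definition thus makes the class index the residue of the position of any
  occurrence.\<close>

lemma letter_class_iff:
  assumes n: "n < r ^ k"
  shows "letter k 0 n \<in> letter_class A r \<theta> p \<longleftrightarrow> int h dvd int n - int p"
proof -
  define a where "a = letter k 0 n"
  have a: "a \<in> A" using letter_in[OF zero n] by (simp add: a_def)
  define z where "z = (LEAST m. \<exists>k\<ge>1. m < length (subst_pow \<theta> k a) \<and> letter k a m = 0)"
  have "\<exists>k\<ge>1. z < length (subst_pow \<theta> k a) \<and> letter k a z = 0"
    unfolding z_def
    by (rule LeastI_ex) (metis primitive_exponent a zero length_subst_pow[OF subst const])
  then obtain k' where z: "z < r ^ k'" "letter k' a z = 0"
    using length_subst_pow[OF subst const a] by auto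
  then have "letter (k' + k) 0 (n * r ^ k' + z) = 0"
    using letter_add[OF zero n] by (simp add: a_def)
  then have "h dvd n * r ^ k' + z" using height_dvd index_less[OF n z(1)] by blast
  then have "int h dvd int n * int r ^ k' + int z"
    by (metis int_dvd_int_iff of_nat_add of_nat_mult of_nat_power)
  then have "int h dvd (int n * int r ^ k' + int z) - int n * (int r ^ k' - 1)"
    by (rule dvd_diff[OF _ dvd_mult[OF height_dvd_power]])
  then have nz: "int h dvd int n + int z" by (simp add: algebra_simps)
  have "a \<in> letter_class A r \<theta> p \<longleftrightarrow> int z mod int h = (- int p) mod int h"
  proof -
    have "letter_residue A r \<theta> a = z mod h" by (simp only: letter_residue_def z_def)
    then show ?thesis using a by (simp add: letter_class_def zmod_int)
  qed
  also have "\<dots> \<longleftrightarrow> int h dvd int z + int p" by (simp add: mod_eq_dvd_iff)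
  also have "\<dots> \<longleftrightarrow> int h dvd (int n + int z) - (int z + int p)"
    using nz by (metis dvd_diff_right_iff)
  finally show ?thesis by (simp add: a_def algebra_simps)
qed

lemma letter_class_cover:
  assumes "a \<in> A"
  obtains i where "i < h" "a \<in> letter_class A r \<theta> i"
proof -
  obtain K n where n: "n < r ^ K" "letter K 0 n = a"
    using primitive_exponent zero assms by metis
  have "int h dvd int n - int (n mod h)" by (simp add: zmod_int)
  then have "a \<in> letter_class A r \<theta> (n mod h)" using letter_class_iff[OF n(1)] n(2) by simp
  then show ?thesis by (intro that[of "n mod h"]) (simp_all add: height_pos)
qed

text \<open>An occurrence of \<open>a\<close> at position \<open>n\<close> yields one of the new
  letter at \<open>n * r ^ k + j\<close>, which is \<open>n + j\<close> modulo \<open>h\<close>. The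
  index \<open>i + j\<close> may exceed \<open>h\<close>, as classes depend on it only modulo
  \<open>h\<close>.\<close>

lemma letter_class_shift:
  assumes "a \<in> letter_class A r \<theta> i" "j < r ^ k"
  shows "letter k a j \<in> letter_class A r \<theta> (i + j)"
proof -
  have a: "a \<in> A" using assms by (simp add: letter_class_def)
  obtain K n where n: "n < r ^ K" "letter K 0 n = a"
    using primitive_exponent zero a by metis
  have "int h dvd int n - int i" using letter_class_iff[OF n(1)] n(2) assms(1) by simp
  then have "int h dvd int n * (int r ^ k - 1) + (int n - int i)"
    using height_dvd_power by (intro dvd_add dvd_mult)
  then have "int h dvd int (n * r ^ k + j) - int (i + j)" by (simp add: algebra_simps)
  then have "letter (k + K) 0 (n * r ^ k + j) \<in> letter_class A r \<theta> (i + j)"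
    using letter_class_iff[OF index_less[OF n(1) assms(2)]] by simp
  then show ?thesis using letter_add[OF zero n(1) assms(2)] n(2) by simp
qed

lemma letter_class_subset: "letter_class A r \<theta> i \<subseteq> A"
  by (auto simp: letter_class_def)

text \<open>The column map at position \<open>j\<close> of \<open>\<theta>^j\<close> is injective
  and moves the class index by \<open>j\<close>.\<close>

lemma card_letter_class_le: "card (letter_class A r \<theta> i) \<le> card (letter_class A r \<theta> (i + j))"
proof (rule card_inj_on_le[of "\<lambda>a. letter j a j"])
  show "inj_on (\<lambda>a. letter j a j) (letter_class A r \<theta> i)"
    using letter_inj[OF _ _ less_power] letter_class_subset by (intro inj_onI) blast
  show "(\<lambda>a. letter j a j) ` letter_class A r \<theta> i \<subseteq> letter_class A r \<theta> (i + j)"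
    using letter_class_shift[OF _ less_power] by blast
  show "finite (letter_class A r \<theta> (i + j))"
    using letter_class_subset finite by (rule finite_subset)
qed

lemma card_letter_class: "card (letter_class A r \<theta> i) = card (letter_class A r \<theta> 0)"
proof (rule antisym)
  \<comment> \<open>Moving on by \<open>h * i - i\<close> reaches a multiple of \<open>h\<close>, so
    the chain of inequalities closes up at class 0.\<close>
  have "i \<le> h * i" using height_pos by simp
  then have "card (letter_class A r \<theta> i) \<le> card (letter_class A r \<theta> (h * i))"
    using card_letter_class_le[of i "h * i - i"] by simp
  also have "letter_class A r \<theta> (h * i) = letter_class A r \<theta> 0"
    by (simp add: letter_class_def)
  finally show "card (letter_class A r \<theta> i) \<le> card (letter_class A r \<theta> 0)" .
  show "card (letter_class A r \<theta> 0) \<le> card (letter_class A r \<theta> i)"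
    using card_letter_class_le[of 0 i] by simp
qed

section \<open>Pair classes\<close>

lemma card_pair_class:
  assumes "j + 2 \<le> r ^ k"
  shows "card (pair_class A r \<theta> i j k) = card (letter_class A r \<theta> 0)"
proof -
  have "inj_on (\<lambda>a. pair k a j) (letter_class A r \<theta> i)"
    using letter_inj[of _ _ j k] letter_class_subset assms by (intro inj_onI) auto
  then show ?thesis using card_letter_class[of i] by (simp only: pair_class_def card_image)
qed

text \<open>Both letters of a pair in a class come from one letter \<open>c\<close>, and by
  \<open>letter_inj\<close> either of them determines \<open>c\<close>.\<close>

lemma pair_class_determined:
  assumes "Q \<in> pair_classes A r \<theta>" "[a, b] \<in> Q" "[a', b'] \<in> Q"
  shows "a = a' \<longleftrightarrow> b = b'"
proof -
  obtain i j k where jk: "j + 2 \<le> r ^ k" and Q: "Q = pair_class A r \<theta> i j k"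
    using assms(1) by (auto simp: pair_classes_def)
  obtain c c' where c: "c \<in> A" "a = letter k c j" "b = letter k c (j + 1)"
    and c': "c' \<in> A" "a' = letter k c' j" "b' = letter k c' (j + 1)"
    using assms(2,3) letter_class_subset unfolding Q pair_class_def by auto
  have "letter k c m = letter k c' m \<longleftrightarrow> c = c'" if "m < r ^ k" for m
    using letter_inj[OF c(1) c'(1) that] by blast
  then show ?thesis unfolding c(2,3) c'(2,3) using jk by simp
qed

text \<open>The bound on \<open>j\<close> forces \<open>1 \<le> k\<close>, because
  \<open>r ^ 0 = 1\<close>.\<close>

lemma pair_class_in: "i < h \<Longrightarrow> j + 2 \<le> r ^ k \<Longrightarrow> pair_class A r \<theta> i j k \<in> pair_classes A r \<theta>"
  unfolding pair_classes_def using gr0_conv_Suc by (cases "k = 0") auto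

lemma pair_in: "a \<in> letter_class A r \<theta> i \<Longrightarrow> pair k a j \<in> pair_class A r \<theta> i j k"
  by (auto simp: pair_class_def)

lemma finite_pair_classes: "finite (pair_classes A r \<theta>)"
proof (rule finite_subset)
  let ?P = "{w. set w \<subseteq> A \<and> length w = 2}"
  show "finite (Pow ?P)" using finite_lists_length_eq[OF finite] by simp
  show "pair_classes A r \<theta> \<subseteq> Pow ?P"
    using letter_class_subset letter_in by (fastforce simp: pair_classes_def pair_class_def)
qed

end

section \<open>The substitution on classes\<close>

locale pair_partition = canonical_substitution +
  fixes e :: "nat list set \<Rightarrow> nat" and n :: nat
  assumes disj: "disjoint (pair_classes A r \<theta>)"
    and bij_e: "bij_betw e (pair_classes A r \<theta>) {0..<n}"
begin

abbreviation \<D> :: "nat list set set" where "\<D> \<equiv> pair_classes A r \<theta>"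

definition color :: "nat list \<Rightarrow> nat" where
  "color p = e (THE Q. Q \<in> \<D> \<and> p \<in> Q)"

text \<open>An arbitrary representative \<open>ab\<close> of the class is substituted;
  \<open>nth_\<phi>\<close> shows that the choice does not matter. For \<open>m = r - 1\<close> the
  pair ends with the first letter of \<open>\<theta>(b)\<close>.\<close>

definition \<phi> :: "nat \<Rightarrow> nat list" where
  "\<phi> q = (let w = subst_word \<theta> (SOME p. p \<in> \<Union>\<D> \<and> color p = q) in
     map (\<lambda>m. color [w ! m, w ! (m + 1)]) [0..<r])"

definition code :: "biword \<Rightarrow> biword" where
  "code x i = color [x i, x (i + 1)]"

lemma color_eq:
  assumes "Q \<in> \<D>" "p \<in> Q"
  shows "color p = e Q"
proof -
  have "(THE Q. Q \<in> \<D> \<and> p \<in> Q) = Q"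
    using assms disj by (intro the_equality) (auto simp: disjoint_def)
  then show ?thesis by (simp add: color_def)
qed

lemma class_eqI: "Q \<in> \<D> \<Longrightarrow> Q' \<in> \<D> \<Longrightarrow> e Q = e Q' \<Longrightarrow> Q = Q'"
  using bij_e by (meson bij_betw_imp_inj_on inj_onD)

lemma class_ex: "q < n \<Longrightarrow> \<exists>Q\<in>\<D>. e Q = q"
  using bij_betw_imp_surj_on[OF bij_e] by (metis atLeastLessThan_iff imageE le0)

lemma color_eqD:
  assumes "Q \<in> \<D>" "p \<in> \<Union>\<D>" "color p = e Q"
  shows "p \<in> Q"
proof -
  obtain X where X: "X \<in> \<D>" "p \<in> X" using assms(2) by blast
  then have "X = Q" using class_eqI[OF X(1) assms(1)] color_eq[OF X] assms(3) by simp
  then show ?thesis using X(2) by simp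
qed

lemma color_less: "p \<in> \<Union>\<D> \<Longrightarrow> color p < n"
  using color_eq bij_e by (auto simp: bij_betw_def)

lemma pair_in_Union:
  assumes "c \<in> A" "j + 2 \<le> r ^ k"
  shows "pair k c j \<in> \<Union>\<D>"
proof -
  obtain i where i: "i < h" "c \<in> letter_class A r \<theta> i" using letter_class_cover assms(1) by metis
  show ?thesis using pair_class_in[OF i(1) assms(2)] pair_in[OF i(2), of k j] by blast
qed

text \<open>Classes are nonempty, because letter \<open>i\<close> of \<open>\<theta>^i(0)\<close>
  belongs to letter class \<open>i\<close>.\<close>

lemma color_ex:
  assumes "q < n"
  obtains c k j where "c \<in> A" "j + 2 \<le> r ^ k" "q = color (pair k c j)"
proof -
  obtain Q where Q: "Q \<in> \<D>" "e Q = q" using class_ex assms by blast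
  then obtain i j k where ij: "i < h" "j + 2 \<le> r ^ k" "Q = pair_class A r \<theta> i j k"
    by (auto simp: pair_classes_def)
  have c: "letter i 0 i \<in> letter_class A r \<theta> i"
    using letter_class_iff[OF less_power, of i i] by simp
  show ?thesis
  proof (rule that)
    show "letter i 0 i \<in> A" using c letter_class_subset by blast
    show "j + 2 \<le> r ^ k" by (rule ij(2))
    show "q = color (pair k (letter i 0 i) j)"
      using color_eq[OF Q(1)] pair_in[OF c] ij(3) Q(2) by simp
  qed
qed

text \<open>The case \<open>t = r\<close> is included: it is the first letter of the second block,
  needed for the last pair of an image.\<close>

lemma nth_subst_word_pair:
  assumes "c \<in> A" "j + 2 \<le> r ^ k" "t \<le> r"
  shows "subst_word \<theta> (pair k c j) ! t = letter (Suc k) c (j * r + t)"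
proof -
  have set: "set (pair k c j) \<subseteq> A" using assms letter_in by auto
  show ?thesis
  proof (cases "t < r")
    case True
    then show ?thesis
      using nth_subst_word[OF const set, of 0 t] letter_Suc[of c j k t] assms by simp
  next
    case False
    then have "t = r" using assms by simp
    then show ?thesis
      using nth_subst_word[OF const set, of 1 0] letter_Suc[of c "j + 1" k 0] assms two_le
      by (simp add: add.commute)
  qed
qed

lemma pair_index_Suc: "j + 2 \<le> r ^ k \<Longrightarrow> t < r \<Longrightarrow> j * r + t + 2 \<le> r ^ Suc k"
proof -
  assume "j + 2 \<le> r ^ k" "t < r"
  then have "j * r + t + 2 \<le> (j + 2) * r" using two_le by simp
  also have "\<dots> \<le> r ^ k * r" using \<open>j + 2 \<le> r ^ k\<close> by (rule mult_le_mono1)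
  finally show ?thesis by (simp add: mult.commute)
qed

text \<open>The representative chosen in \<open>\<phi>\<close> is the pair at \<open>j\<close> of
  \<open>\<theta>^k(f)\<close> with \<open>f\<close> in the letter class of \<open>c\<close>. The
  image pairs coming from \<open>f\<close> and from \<open>c\<close> then lie in the common class
  \<open>?Q'\<close>.\<close>

lemma nth_\<phi>:
  assumes c: "c \<in> A" and j: "j + 2 \<le> r ^ k" and t: "t < r"
  shows "\<phi> (color (pair k c j)) ! t = color (pair (Suc k) c (j * r + t))"
proof -
  obtain i where i: "i < h" "c \<in> letter_class A r \<theta> i" using letter_class_cover c by metis
  let ?Q = "pair_class A r \<theta> i j k" and ?Q' = "pair_class A r \<theta> i (j * r + t) (Suc k)"
  have Q: "?Q \<in> \<D>" "?Q' \<in> \<D>" using pair_class_in i j pair_index_Suc[OF j t] by blast+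
  define p where "p = (SOME p. p \<in> \<Union>\<D> \<and> color p = color (pair k c j))"
  have "p \<in> \<Union>\<D> \<and> color p = color (pair k c j)"
    unfolding p_def by (rule someI_ex) (use pair_in_Union[OF c j] in blast)
  then have "p \<in> ?Q" using color_eqD[OF Q(1)] color_eq[OF Q(1) pair_in[OF i(2)]] by simp
  then obtain f where f: "f \<in> letter_class A r \<theta> i" "p = pair k f j"
    by (auto simp: pair_class_def)
  then have "f \<in> A" using letter_class_subset by blast
  then have "[subst_word \<theta> p ! t, subst_word \<theta> p ! (t + 1)] = pair (Suc k) f (j * r + t)"
    using nth_subst_word_pair[OF _ j, of f] t f(2) by (simp add: add.assoc)
  then have "\<phi> (color (pair k c j)) ! t = color (pair (Suc k) f (j * r + t))"
    unfolding \<phi>_def p_def[symmetric] Let_def using t by simp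
  also have "\<dots> = color (pair (Suc k) c (j * r + t))"
    using color_eq[OF Q(2) pair_in[OF f(1)]] color_eq[OF Q(2) pair_in[OF i(2)]] by simp
  finally show ?thesis .
qed

lemma length_\<phi>: "length (\<phi> q) = r"
  by (simp add: \<phi>_def Let_def)

lemma const_\<phi>: "constant_length {0..<n} r \<phi>"
  by (simp add: constant_length_def length_\<phi>)

lemma subst_\<phi>: "substitution {0..<n} \<phi>"
  unfolding substitution_def
proof
  fix q assume "q \<in> {0..<n}"
  then obtain c k j where q: "c \<in> A" "j + 2 \<le> r ^ k" "q = color (pair k c j)"
    by (metis color_ex atLeastLessThan_iff)
  have "\<phi> q ! t < n" if "t < r" for t
    using color_less[OF pair_in_Union[OF q(1) pair_index_Suc[OF q(2) that]]] nth_\<phi>[OF q(1,2) that] q(3)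
    by simp
  then have "set (\<phi> q) \<subseteq> {0..<n}" by (auto simp: in_set_conv_nth length_\<phi>)
  then show "\<phi> q \<noteq> [] \<and> set (\<phi> q) \<subseteq> {0..<n}" using length_\<phi>[of q] two_le by auto
qed

lemma length_\<phi>_pow: "q < n \<Longrightarrow> length (subst_pow \<phi> k q) = r ^ k"
  by (rule length_subst_pow[OF subst_\<phi> const_\<phi>]) simp

text \<open>For the largest \<open>t\<close> the pair straddles the blocks of letters
  \<open>j\<close> and \<open>j + 1\<close>; the hypothesis on \<open>j\<close> provides both
  blocks.\<close>

lemma pair_index: "j + 2 \<le> r ^ l \<Longrightarrow> t < r ^ k \<Longrightarrow> j * r ^ k + t + 2 \<le> r ^ (k + l)"
proof (cases "k = 0")
  case False
  assume *: "j + 2 \<le> r ^ l" "t < r ^ k"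
  have "2 \<le> r ^ k" using power_increasing[of 1 k r] False two_le by simp
  then have "j * r ^ k + t + 2 \<le> (j + 2) * r ^ k" using * by simp
  also have "\<dots> \<le> r ^ l * r ^ k" using *(1) by (rule mult_le_mono1)
  finally show ?thesis by (simp add: power_add mult.commute)
qed simp

lemma nth_\<phi>_pow:
  assumes c: "c \<in> A" and j: "j + 2 \<le> r ^ l" and "t < r ^ k"
  shows "subst_pow \<phi> k (color (pair l c j)) ! t = color (pair (k + l) c (j * r ^ k + t))"
  using assms(3)
proof (induction k arbitrary: t)
  case 0
  then show ?case by (simp add: subst_pow_0)
next
  case (Suc k)
  let ?q = "color (pair l c j)" and ?s = "t div r" and ?m = "t mod r"
  have q: "?q \<in> {0..<n}" using color_less pair_in_Union[OF c j] by simp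
  have s: "?s < r ^ k" "?m < r"
    using Suc.prems two_le by (simp_all add: less_mult_imp_div_less mult.commute)
  have "subst_pow \<phi> (Suc k) ?q ! t = \<phi> (subst_pow \<phi> k ?q ! ?s) ! ?m"
    using nth_subst_pow_add[OF subst_\<phi> const_\<phi> q s(1), of ?m "Suc 0"] s(2) by (simp add: subst_pow_1)
  also have "\<dots> = \<phi> (color (pair (k + l) c (j * r ^ k + ?s))) ! ?m"
    by (simp only: Suc.IH[OF s(1)])
  also have "\<dots> = color (pair (Suc (k + l)) c ((j * r ^ k + ?s) * r + ?m))"
    by (rule nth_\<phi>[OF c pair_index[OF j s(1)] s(2)])
  also have "(j * r ^ k + ?s) * r + ?m = j * r ^ Suc k + t"
    by (simp add: algebra_simps)
  finally show ?case by simp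
qed

text \<open>As long as \<open>t + 2 \<le> r ^ k\<close>, the pair stays inside the image of the
  first letter, so the second letter of the initial pair has no influence.\<close>

lemma nth_\<phi>_pow_prefix:
  assumes c: "c \<in> A" and j: "j + 2 \<le> r ^ l" and t: "t + 2 \<le> r ^ k"
  shows "subst_pow \<phi> k (color (pair l c j)) ! t = color (pair k (letter l c j) t)"
  using nth_\<phi>_pow[OF c j, of t k] letter_add[OF c, of j l t k] letter_add[OF c, of j l "t + 1" k] j t
  by simp

text \<open>Let \<open>a'\<close> be the first letter of a pair of color \<open>a\<close>.
  Primitivity of \<open>\<theta>\<close> produces in \<open>\<theta>^K(a')\<close> any letter
  \<open>d\<close> whose images contain a pair of color \<open>b\<close>, and by the prefix property
  that pair persists in all higher powers.\<close>

lemma primitive_\<phi>: "primitive {0..<n} \<phi>"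
proof -
  obtain K where K: "1 \<le> K" "\<And>a b. a \<in> A \<Longrightarrow> b \<in> A \<Longrightarrow> \<exists>j<r ^ K. letter K a j = b"
    using primitive_exponent by blast
  have "\<exists>l. \<exists>c\<in>A. \<exists>j. j + 2 \<le> r ^ l \<and> q = color (pair l c j)" if "q \<in> {0..<n}" for q
    using color_ex that by (metis atLeastLessThan_iff)
  then obtain l where l: "\<And>q. q \<in> {0..<n} \<Longrightarrow> \<exists>c\<in>A. \<exists>j. j + 2 \<le> r ^ l q \<and> q = color (pair (l q) c j)"
    by metis
  \<comment> \<open>The sum serves as a common bound for the exponents \<open>l q\<close>, so that
    one power works for all colors.\<close>
  define L where "L = (\<Sum>q\<in>{0..<n}. l q)"
  have L: "l q \<le> L" if "q \<in> {0..<n}" for q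
    unfolding L_def using that by (intro member_le_sum) auto
  have "b \<in> set (subst_pow \<phi> (K + L) a)" if a: "a \<in> {0..<n}" and b: "b \<in> {0..<n}" for a b
  proof -
    obtain c j where c: "c \<in> A" and j: "j + 2 \<le> r ^ l a" and a_eq: "a = color (pair (l a) c j)"
      using l[OF a] by blast
    obtain d i where d: "d \<in> A" and i: "i + 2 \<le> r ^ l b" and b_eq: "b = color (pair (l b) d i)"
      using l[OF b] by blast
    define a' where "a' = letter (l a) c j"
    have a': "a' \<in> A" using letter_in[OF c] j by (simp add: a'_def)
    obtain u where u: "u < r ^ K" "letter K a' u = d" using K(2)[OF a' d] by blast
    let ?t = "u * r ^ l b + i"
    have t: "?t + 2 \<le> r ^ (l b + K)" using index_less[OF u(1), of "i + 1" "l b"] i by simp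
    have t': "?t + 2 \<le> r ^ (K + L)"
      using t power_increasing[of "l b + K" "K + L" r] L[OF b] two_le by linarith
    have "letter (K + L) a' v = letter (l b + K) a' v" if "v < r ^ (l b + K)" for v
      using letter_prefix[OF a' that, of "L - l b"] L[OF b] by (simp add: add.commute)
    then have "pair (K + L) a' ?t = pair (l b + K) a' ?t" using t by simp
    also have "\<dots> = pair (l b) d i"
      using letter_add[OF a' u(1), of i "l b"] letter_add[OF a' u(1), of "i + 1" "l b"] i u(2) by simp
    finally have "subst_pow \<phi> (K + L) a ! ?t = b"
      using nth_\<phi>_pow_prefix[OF c j t'] a_eq b_eq by (simp add: a'_def)
    moreover have "?t < length (subst_pow \<phi> (K + L) a)" using length_\<phi>_pow a t' by simp
    ultimately show ?thesis using nth_mem by metis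
  qed
  then show ?thesis unfolding primitive_def using K(1) by (intro exI[of _ "K + L"]) auto
qed

section \<open>The code and its injectivity for a given letter at the origin\<close>

lemma subst_shift_pair:
  assumes "x \<in> subst_shift A \<theta>"
  obtains a k t where "a \<in> A" "N \<le> t" "t + N + 2 \<le> r ^ k"
    "\<And>u. \<bar>u\<bar> \<le> int N \<Longrightarrow> [x u, x (u + 1)] = pair k a (nat (int t + u))"
proof -
  \<comment> \<open>Radius \<open>N + 1\<close> makes room for the second letter of the pair at
    \<open>u = N\<close>.\<close>
  obtain a k t where a: "a \<in> A" "N + 1 \<le> t" "t + (N + 1) < length (subst_pow \<theta> k a)"
    and x: "\<And>u. \<bar>u\<bar> \<le> int (N + 1) \<Longrightarrow> x u = letter k a (nat (int t + u))"
    using assms[unfolded subst_shift_iff, rule_format, of "N + 1"] by blast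
  have "[x u, x (u + 1)] = pair k a (nat (int t + u))" if "\<bar>u\<bar> \<le> int N" for u
  proof -
    have "nat (int t + (u + 1)) = nat (int t + u) + 1" using that a by linarith
    then show ?thesis using x[of u] x[of "u + 1"] that by simp
  qed
  then show ?thesis using that[of a t k] a by (simp add: length_subst_pow[OF subst const])
qed

lemma subst_shift_pair_in: "x \<in> subst_shift A \<theta> \<Longrightarrow> [x i, x (i + 1)] \<in> \<Union>\<D>"
proof -
  assume "x \<in> subst_shift A \<theta>"
  then obtain a k t where a: "a \<in> A" "nat \<bar>i\<bar> \<le> t" "t + nat \<bar>i\<bar> + 2 \<le> r ^ k"
    "[x i, x (i + 1)] = pair k a (nat (int t + i))"
    by (rule subst_shift_pair[of x "nat \<bar>i\<bar>"]) auto
  then have "nat (int t + i) + 2 \<le> r ^ k" by linarith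
  then show ?thesis using pair_in_Union[OF a(1)] a(4) by metis
qed

text \<open>A window of \<open>x\<close> lies in some \<open>\<theta>^k(a)\<close>. For a color
  \<open>?q\<close> of a pair that starts with \<open>a\<close>, the word
  \<open>\<phi>^k(?q)\<close> begins with the colors of the pairs of
  \<open>\<theta>^k(a)\<close>.\<close>

lemma code_in:
  assumes "x \<in> subst_shift A \<theta>"
  shows "code x \<in> subst_shift {0..<n} \<phi>"
  unfolding subst_shift_iff
proof
  fix N
  obtain a k t where a: "a \<in> A" and t: "N \<le> t" "t + N + 2 \<le> r ^ k"
    and x: "\<And>u. \<bar>u\<bar> \<le> int N \<Longrightarrow> [x u, x (u + 1)] = pair k a (nat (int t + u))"
    using subst_shift_pair[OF assms, of N] by metis
  obtain l j where j: "j + 1 < r ^ l" "letter l 0 j = a" using ex_pair_first[OF a] by metis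
  then have j2: "j + 2 \<le> r ^ l" by simp
  let ?q = "color (pair l 0 j)"
  have q: "?q < n" using color_less pair_in_Union[OF zero j2] by blast
  have "code x u = subst_pow \<phi> k ?q ! nat (int t + u)" if "\<bar>u\<bar> \<le> int N" for u
  proof -
    have "nat (int t + u) + 2 \<le> r ^ k" using that t by linarith
    then show ?thesis
      using nth_\<phi>_pow_prefix[OF zero j2] j(2) x[OF that] by (simp add: code_def)
  qed
  then show "\<exists>a\<in>{0..<n}. \<exists>k t. N \<le> t \<and> t + N < length (subst_pow \<phi> k a) \<and>
      (\<forall>u. \<bar>u\<bar> \<le> int N \<longrightarrow> code x u = subst_pow \<phi> k a ! nat (int t + u))"
    using q t length_\<phi>_pow[OF q, of k]
    by (intro bexI[of _ ?q] exI[of _ k] exI[of _ t]) auto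
qed

text \<open>A letter and the colors determine a word in both directions, since by bijectivity either
  letter of a pair determines the other one within its class.\<close>

lemma code_determines:
  assumes "f 0 = g 0"
    and "\<And>u. \<bar>u\<bar> \<le> int N \<Longrightarrow>
      [f u, f (u + 1)] \<in> \<Union>\<D> \<and> [g u, g (u + 1)] \<in> \<Union>\<D> \<and> code f u = code g u"
    and "\<bar>u\<bar> \<le> int N"
  shows "f u = g u"
proof -
  have step: "f u = g u \<longleftrightarrow> f (u + 1) = g (u + 1)" if u: "\<bar>u\<bar> \<le> int N" for u
  proof -
    obtain Q where Q: "Q \<in> \<D>" "[f u, f (u + 1)] \<in> Q" using assms(2)[OF u] by blast
    have "[g u, g (u + 1)] \<in> Q"
      using color_eqD[OF Q(1)] color_eq[OF Q] assms(2)[OF u] by (simp add: code_def)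
    then show ?thesis using pair_class_determined[OF Q] by blast
  qed
  have "f (int m) = g (int m) \<and> f (- int m) = g (- int m)" if "m \<le> N" for m
    using that
  proof (induction m)
    case (Suc m)
    have "- int m = - int (Suc m) + 1" by simp
    then show ?case
      using Suc step[of "int m"] step[of "- int (Suc m)"] by (simp add: add.commute)
  qed (use assms(1) in simp)
  from this[of "nat \<bar>u\<bar>"] show ?thesis using assms(3) by (cases "0 \<le> u") auto
qed

lemma code_inj:
  assumes "x \<in> subst_shift A \<theta>" "x' \<in> subst_shift A \<theta>" "code x = code x'" "x 0 = x' 0"
  shows "x = x'"
proof
  fix u
  show "x u = x' u"
    using code_determines[of x x' "nat \<bar>u\<bar>" u] subst_shift_pair_in assms by simp
qed

section \<open>Preimages and the size of the fibers\<close>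

lemma ex_preimage_window:
  assumes y: "y \<in> subst_shift {0..<n} \<phi>" and Q: "Q \<in> \<D>" "e Q = y 0" and p: "p \<in> Q"
  shows "\<exists>k c t. c \<in> A \<and> N \<le> t \<and> t + N + 2 \<le> r ^ k \<and> pair k c t = p \<and>
    (\<forall>u. \<bar>u\<bar> \<le> int N \<longrightarrow> color (pair k c (nat (int t + u))) = y u)"
proof -
  obtain q k t where q: "q \<in> {0..<n}" and t: "N \<le> t" "t + N < length (subst_pow \<phi> k q)"
    and yu: "\<And>u. \<bar>u\<bar> \<le> int N \<Longrightarrow> y u = subst_pow \<phi> k q ! nat (int t + u)"
    using y[unfolded subst_shift_iff, rule_format, of N] by blast
  obtain c l j where c: "c \<in> A" and j: "j + 2 \<le> r ^ l" and q_eq: "q = color (pair l c j)"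
    using color_ex q by (metis atLeastLessThan_iff)
  have tN: "t + N < r ^ k" using t length_\<phi>_pow q by simp
  define s where "s = j * r ^ k + t"
  have s: "N \<le> s" "s + N + 2 \<le> r ^ (k + l)"
    using t(1) pair_index[OF j tN] by (simp_all add: s_def add.assoc)
  have ys: "y u = color (pair (k + l) c (nat (int s + u)))" if "\<bar>u\<bar> \<le> int N" for u
  proof -
    have "nat (int t + u) < r ^ k" "j * r ^ k + nat (int t + u) = nat (int s + u)"
      using that t(1) tN unfolding s_def by linarith+
    then show ?thesis using nth_\<phi>_pow[OF c j, of "nat (int t + u)" k] yu[OF that] q_eq by simp
  qed
  obtain i where i: "i < h" "c \<in> letter_class A r \<theta> i" using letter_class_cover c by metis
  have Q_in: "pair_class A r \<theta> i (nat (int s + u)) (k + l) \<in> \<D>" if "\<bar>u\<bar> \<le> int N" for u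
    using that s by (intro pair_class_in[OF i(1)]) linarith
  let ?Q = "pair_class A r \<theta> i s (k + l)"
  have "?Q \<in> \<D>" "e ?Q = y 0"
    using Q_in[of 0] ys[of 0] color_eq[OF _ pair_in[OF i(2)], of s "k + l"] by simp_all
  \<comment> \<open>The class at the center has color \<open>y 0\<close>, so it is \<open>Q\<close>;
    therefore \<open>p\<close> comes from a letter \<open>d\<close> in the class of
    \<open>c\<close>, and \<open>d\<close> gives the same colors throughout the window.\<close>
  then have "?Q = Q" using Q by (intro class_eqI) simp_all
  then obtain d where d: "d \<in> letter_class A r \<theta> i" "pair (k + l) d s = p"
    using p by (auto simp: pair_class_def)
  have "color (pair (k + l) d (nat (int s + u))) = y u" if "\<bar>u\<bar> \<le> int N" for u
    using color_eq[OF Q_in[OF that] pair_in[OF d(1)]] color_eq[OF Q_in[OF that] pair_in[OF i(2)]]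
      ys[OF that] by simp
  then show ?thesis using d letter_class_subset s by blast
qed

text \<open>The window preimages of different radii share the pair \<open>p\<close> at the origin
  and the colors of \<open>y\<close>, so \<open>code_determines\<close> makes them agree wherever
  they overlap. They glue directly, without passing to a convergent subsequence.\<close>

lemma ex_preimage:
  assumes y: "y \<in> subst_shift {0..<n} \<phi>" and Q: "Q \<in> \<D>" "e Q = y 0" and p: "p \<in> Q"
  shows "\<exists>x\<in>subst_shift A \<theta>. code x = y \<and> [x 0, x 1] = p"
proof -
  obtain k c t where A: "\<And>N. c N \<in> A" and t: "\<And>N. N \<le> t N" "\<And>N. t N + N + 2 \<le> r ^ k N"
    and p0: "\<And>N. pair (k N) (c N) (t N) = p"
    and yu: "\<And>N u. \<bar>u\<bar> \<le> int N \<Longrightarrow> color (pair (k N) (c N) (nat (int (t N) + u))) = y u"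
    using ex_preimage_window[OF assms] by metis
  define f where "f N u = letter (k N) (c N) (nat (int (t N) + u))" for N u
  have pair: "[f N u, f N (u + 1)] = pair (k N) (c N) (nat (int (t N) + u))" if "\<bar>u\<bar> \<le> int N" for N u
  proof -
    have "nat (int (t N) + (u + 1)) = nat (int (t N) + u) + 1" using that t(1)[of N] by linarith
    then show ?thesis by (simp add: f_def)
  qed
  have f_in: "[f N u, f N (u + 1)] \<in> \<Union>\<D>" if "\<bar>u\<bar> \<le> int N" for N u
    unfolding pair[OF that] using that t[of N] by (intro pair_in_Union[OF A]) linarith
  have f_code: "code (f N) u = y u" if "\<bar>u\<bar> \<le> int N" for N u
    unfolding code_def pair[OF that] by (rule yu[OF that])
  have f0: "[f N 0, f N 1] = p" for N
    using pair[of 0 N] p0[of N] by simp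
  define x where "x u = f (nat \<bar>u\<bar>) u" for u
  have x_eq: "x u = f N u" if "\<bar>u\<bar> \<le> int N" for N u
    unfolding x_def
  proof (rule code_determines[where f = "f (nat \<bar>u\<bar>)" and g = "f N" and N = "nat \<bar>u\<bar>"])
    show "f (nat \<bar>u\<bar>) 0 = f N 0" using f0[of "nat \<bar>u\<bar>"] f0[of N] by (metis list.inject)
    fix v :: int assume "\<bar>v\<bar> \<le> int (nat \<bar>u\<bar>)"
    then show "[f (nat \<bar>u\<bar>) v, f (nat \<bar>u\<bar>) (v + 1)] \<in> \<Union>\<D> \<and> [f N v, f N (v + 1)] \<in> \<Union>\<D> \<and>
        code (f (nat \<bar>u\<bar>)) v = code (f N) v"
      using f_in[of v] f_code[of v] that by simp
  qed simp
  have "x \<in> subst_shift A \<theta>"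
    unfolding subst_shift_iff
  proof
    fix N
    show "\<exists>a\<in>A. \<exists>k t. N \<le> t \<and> t + N < length (subst_pow \<theta> k a) \<and>
        (\<forall>u. \<bar>u\<bar> \<le> int N \<longrightarrow> x u = letter k a (nat (int t + u)))"
      using A[of N] t[of N] x_eq[of _ N]
      by (intro bexI[of _ "c N"] exI[of _ "k N"] exI[of _ "t N"])
        (auto simp: length_subst_pow[OF subst const] f_def)
  qed
  moreover have "code x u = y u" for u
  proof -
    \<comment> \<open>The radius exceeds \<open>\<bar>u\<bar>\<close> by 1 so that coordinate
      \<open>u + 1\<close> is covered as well.\<close>
    have "code x u = code (f (nat \<bar>u\<bar> + 1)) u"
      using x_eq[of u "nat \<bar>u\<bar> + 1"] x_eq[of "u + 1" "nat \<bar>u\<bar> + 1"] by (simp add: code_def)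
    then show ?thesis using f_code[of u "nat \<bar>u\<bar> + 1"] by simp
  qed
  moreover have "[x 0, x 1] = p" using f0[of 1] x_eq[of 0 1] x_eq[of 1 1] by simp
  ultimately show ?thesis by blast
qed

lemma fiber:
  assumes y: "y \<in> subst_shift {0..<n} \<phi>" and Q: "Q \<in> \<D>" "e Q = y 0"
  shows "bij_betw (\<lambda>x. [x 0, x 1]) {x \<in> subst_shift A \<theta>. code x = y} Q"
proof (rule bij_betw_imageI)
  show "inj_on (\<lambda>x. [x 0, x 1]) {x \<in> subst_shift A \<theta>. code x = y}"
    by (rule inj_onI, rule code_inj) auto
  have "[x 0, x 1] \<in> Q" if "x \<in> subst_shift A \<theta>" "code x = y" for x
  proof (rule color_eqD[OF Q(1)])
    show "[x 0, x 1] \<in> \<Union>\<D>" using subst_shift_pair_in[OF that(1), of 0] by simp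
    show "color [x 0, x 1] = e Q" using that(2) Q(2) by (auto simp: code_def)
  qed
  moreover have "Q \<subseteq> (\<lambda>x. [x 0, x 1]) ` {x \<in> subst_shift A \<theta>. code x = y}"
    using ex_preimage[OF y Q] by fastforce
  ultimately show "(\<lambda>x. [x 0, x 1]) ` {x \<in> subst_shift A \<theta>. code x = y} = Q" by blast
qed

lemma card_class: "Q \<in> \<D> \<Longrightarrow> card Q = card (letter_class A r \<theta> 0)"
  using card_pair_class by (auto simp: pair_classes_def)

lemma card_letter_class_pos: "0 < card (letter_class A r \<theta> 0)"
proof -
  have "0 \<in> letter_class A r \<theta> 0"
    using letter_class_iff[of 0 0 0] by (simp add: subst_pow_0)
  then show ?thesis using finite_subset[OF letter_class_subset finite] card_gt_0_iff by blast
qed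

lemma sliding_block_code_code: "sliding_block_code (subst_shift A \<theta>) (subst_shift {0..<n} \<phi>) code"
  unfolding sliding_block_code_def
  by (intro conjI exI[of _ 0] exI[of _ 1] exI[of _ color])
    (auto simp: code_in code_def map_upto_two)

lemma extension_code:
  "extension_to_one (subst_shift A \<theta>) (subst_shift {0..<n} \<phi>) code (card (letter_class A r \<theta> 0))"
proof -
  let ?c = "card (letter_class A r \<theta> 0)" and ?F = "\<lambda>y. {x \<in> subst_shift A \<theta>. code x = y}"
  have fib: "card (?F y) = ?c" if y: "y \<in> subst_shift {0..<n} \<phi>" for y
  proof -
    have "y 0 < n" using subst_shift_subset[OF subst_\<phi> y, of 0] by simp
    then obtain Q where Q: "Q \<in> \<D>" "e Q = y 0" using class_ex by blast
    show ?thesis using bij_betw_same_card[OF fiber[OF y Q]] card_class[OF Q(1)] by simp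
  qed
  \<comment> \<open>Infinite sets have \<open>card\<close> 0, so a positive cardinality yields
    finiteness along with nonemptiness; the latter gives surjectivity below.\<close>
  then have fin: "finite (?F y)" "?F y \<noteq> {}" if "y \<in> subst_shift {0..<n} \<phi>" for y
    using card_letter_class_pos that card_gt_0_iff[of "?F y"] by auto
  have "code ` subst_shift A \<theta> = subst_shift {0..<n} \<phi>"
    using code_in fin(2) by blast
  then show ?thesis
    unfolding extension_to_one_def using sliding_block_code_code fib fin(1) by blast
qed

end

section \<open>Exclusion of length one and the conclusion\<close>

text \<open>All powers at a letter have length 1, which leaves no room for a window of three
  letters.\<close>

lemma subst_shift_length_one:
  assumes "substitution A \<theta>" "constant_length A 1 \<theta>"
  shows "subst_shift A \<theta> = {}"
proof -
  have False if x: "x \<in> subst_shift A \<theta>" for x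
  proof -
    obtain a k t where "a \<in> A" "1 \<le> t" "t + 1 < length (subst_pow \<theta> k a)"
      using x[unfolded subst_shift_iff, rule_format, of 1] by blast
    then show False using length_subst_pow[OF assms, of a k] by simp
  qed
  then show ?thesis by blast
qed

theorem theorem41:
  fixes s r n :: nat and A :: "nat set" and \<theta> :: "nat \<Rightarrow> nat list"
  assumes "A = {0..s}"
    and "substitution A \<theta>"
    and "constant_length A r \<theta>"
    and "primitive A \<theta>"
    and "aperiodic A \<theta>"
    and "bijective A r \<theta>"
    and "canonical_form A r \<theta>"
    and "disjoint (pair_classes A r \<theta>)"
    and "\<Union> (pair_classes A r \<theta>) = legal_pairs A \<theta>"
    and "card (pair_classes A r \<theta>) = n"
  shows "\<exists>\<phi> \<Psi> c. substitution {0..<n} \<phi> \<and> primitive {0..<n} \<phi> \<and>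
           sliding_block_code (subst_shift A \<theta>) (subst_shift {0..<n} \<phi>) \<Psi> \<and>
           (\<forall>Q\<in>pair_classes A r \<theta>. card Q = c) \<and>
           extension_to_one (subst_shift A \<theta>) (subst_shift {0..<n} \<phi>) \<Psi> c"
proof -
  have zero: "0 \<in> A" using assms(1) by simp
  have "r \<noteq> 0" using assms(2,3) zero by (force simp: substitution_def constant_length_def)
  \<comment> \<open>Aperiodicity supplies a fixed point inside the subshift, which would be empty
    for length one.\<close>
  moreover have "r \<noteq> 1"
    using assms(5) subst_shift_length_one[OF assms(2)] assms(3)
    by (auto simp: aperiodic_def fixed_points_def)
  ultimately have "2 \<le> r" by simp
  then interpret canonical_substitution A r \<theta>
    using assms zero by unfold_locales simp_all
  obtain e where "bij_betw e (pair_classes A r \<theta>) {0..<n}"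
    using ex_bij_betw_finite_nat[OF finite_pair_classes] assms(10) by blast
  then interpret pair_partition A r \<theta> e n
    using assms(8) by unfold_locales
  show ?thesis
    using subst_\<phi> primitive_\<phi> sliding_block_code_code card_class extension_code by blast
qed

end
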